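(* Let $n\ge1$, let $\mathbf a=(a_k)_{0\le k\le 2n-2}$ be a random vector with independent real-valued coordinates, and let $A$ be the $n\times n$ Toeplitz matrix $$A=\begin{bmatrix}a_{n-1}&a_{n-2}&\ldots&a_0\\ a_n&a_{n-1}&\ldots&a_1\\ \vdots&\vdots&\ddots&\vdots\\ a_{2n-2}&a_{2n-3}&\ldots&a_{n-1}\end{bmatrix}.$$ Then for any $\varepsilon>0$, $$\mathbb P\left(|\det A|^{1/n}<\varepsilon\right)\le n\,\mathcal L(a_{n-1},\varepsilon).$$
   Context: Lévy concentration function: for a real random variable $\xi$ and $\delta>0$, $\mathcal L(\xi,\delta)=\sup_{t\in\mathbb R}\mathbb P(|\xi-t|<\delta)$. *)

theory Defs
  imports "HOL-Probability.Probability" "Jordan_Normal_Form.Determinant"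
begin

(* The supremum is over a nonempty set bounded above by 1 when M is a probability
   space, so the SUP of the conditionally complete lattice of reals is the usual one. *)
definition levy_concentration :: "'a measure \<Rightarrow> ('a \<Rightarrow> real) \<Rightarrow> real \<Rightarrow> real" where
  "levy_concentration M X d = (SUP t. measure M {w \<in> space M. \<bar>X w - t\<bar> < d})"

(* Rows and columns are numbered from 0. The natural subtraction never truncates,
   since j \<le> n - 1 for the entries of the matrix. *)
definition toeplitz_mat :: "nat \<Rightarrow> (nat \<Rightarrow> real) \<Rightarrow> real mat" where
  "toeplitz_mat n a = Matrix.mat n n (\<lambda>(i, j). a (n - 1 + i - j))"

end

theory Submission
  imports Defs "Jordan_Normal_Form.Char_Poly"
begin

text \<open>
  As a function of the diagonal entry \<open>x\<close>, with the other entries fixed, the determinant is a monic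
  polynomial of degree \<open>n\<close>, hence \<open>\<Prod> (x - z\<^sub>i)\<close> over \<open>n\<close> complex roots. If its absolute value is below
  \<open>\<epsilon>\<^sup>n\<close>, then some factor satisfies \<open>\<bar>x - z\<^sub>i\<bar> < \<epsilon>\<close>, so \<open>x\<close> is within \<open>\<epsilon>\<close> of the real part of \<open>z\<^sub>i\<close>.
  Conditioning on the other entries and a union bound over the roots give the estimate.
\<close>

text \<open>The determinant is the characteristic polynomial of \<open>- B\<close> at
  \<open>x\<close>, which splits into linear factors over the complex numbers. The list
  \<open>zs\<close> holds the eigenvalues of \<open>- B\<close> with multiplicity, so it is the same
  for every \<open>x\<close>.\<close>

lemma det_diagonal_shift_factorized:
  fixes B :: "real mat"
  assumes B: "B \<in> carrier_mat n n"
  obtains zs :: "complex list" where "length zs = n"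
    and "\<And>x. complex_of_real (Determinant.det (x \<cdot>\<^sub>m 1\<^sub>m n + B)) = (\<Prod>z\<leftarrow>zs. of_real x - z)"
proof -
  define C where "C = map_mat complex_of_real (- B)"
  have C: "C \<in> carrier_mat n n"
    using B by (simp add: C_def)
  obtain zs where zs: "char_poly C = (\<Prod>z\<leftarrow>zs. [:- z, 1:])" "length zs = n"
    using char_poly_factorized[OF C] by blast
  have "complex_of_real (Determinant.det (x \<cdot>\<^sub>m 1\<^sub>m n + B)) = (\<Prod>z\<leftarrow>zs. of_real x - z)" for x
  proof -
    have "complex_of_real (Determinant.det (x \<cdot>\<^sub>m 1\<^sub>m n + B))
        = Determinant.det (map_mat complex_of_real (x \<cdot>\<^sub>m 1\<^sub>m n + B))"
      by (simp add: of_real_hom.hom_det)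
    \<comment> \<open>\<open>char_matrix C e\<close> is \<open>C\<close> minus \<open>e\<close>
      times the identity, so both the outer minus sign and the one inside \<open>C\<close> are
      needed to recover \<open>x\<close> times the identity plus \<open>B\<close>.\<close>
    also have "map_mat complex_of_real (x \<cdot>\<^sub>m 1\<^sub>m n + B) = - char_matrix C (of_real x)"
      using B by (intro eq_matI) (auto simp: C_def char_matrix_def)
    also have "Determinant.det (- char_matrix C (of_real x)) = poly (char_poly C) (of_real x)"
      by (simp add: char_poly_matrix[OF C])
    also have "\<dots> = (\<Prod>z\<leftarrow>zs. of_real x - z)"
      by (simp add: zs poly_prod_list o_def)
    finally show ?thesis .
  qed
  with zs(2) show thesis
    using that by blast
qed

lemma prod_list_norm_ge_power:
  fixes f :: "'b \<Rightarrow> 'c :: real_normed_field"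
  assumes "\<And>z. z \<in> set zs \<Longrightarrow> norm (f z) \<ge> e" and "e \<ge> 0"
  shows "norm (\<Prod>z\<leftarrow>zs. f z) \<ge> e ^ length zs"
  using assms by (induction zs) (auto simp: norm_mult intro!: mult_mono)

text \<open>If all \<open>n\<close> factors had norm at least \<epsilon>, so would the
  \<open>n\<close>-th root of their product. Passing to real parts only shortens distances to a real
  \<open>x\<close>, so \<open>map Re zs\<close> serves as \<open>ts\<close>.\<close>

lemma det_diagonal_shift_small:
  fixes B :: "real mat"
  assumes B: "B \<in> carrier_mat n n" and "n \<ge> 1" and "\<epsilon> > 0"
  obtains ts :: "real list" where "length ts = n"
    and "\<And>x. root n \<bar>Determinant.det (x \<cdot>\<^sub>m 1\<^sub>m n + B)\<bar> < \<epsilon> \<Longrightarrow> \<exists>t\<in>set ts. \<bar>x - t\<bar> < \<epsilon>"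
proof -
  obtain zs :: "complex list" where zs: "length zs = n"
    "\<And>x. complex_of_real (Determinant.det (x \<cdot>\<^sub>m 1\<^sub>m n + B)) = (\<Prod>z\<leftarrow>zs. of_real x - z)"
    using det_diagonal_shift_factorized[OF B] by blast
  have "\<exists>t\<in>set (map Re zs). \<bar>x - t\<bar> < \<epsilon>"
    if small: "root n \<bar>Determinant.det (x \<cdot>\<^sub>m 1\<^sub>m n + B)\<bar> < \<epsilon>" for x
  proof (rule ccontr)
    assume "\<not> ?thesis"
    hence far: "\<epsilon> \<le> \<bar>x - Re z\<bar>" if "z \<in> set zs" for z
      using that by (auto simp: not_less)
    have "\<epsilon> \<le> norm (of_real x - z)" if "z \<in> set zs" for z
      using far[OF that] abs_Re_le_cmod[of "of_real x - z"] by simp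
    hence "\<epsilon> ^ n \<le> norm (\<Prod>z\<leftarrow>zs. of_real x - z)"
      using prod_list_norm_ge_power[of zs \<epsilon> "\<lambda>z. of_real x - z"] \<open>\<epsilon> > 0\<close> zs(1) by simp
    also have "\<dots> = \<bar>Determinant.det (x \<cdot>\<^sub>m 1\<^sub>m n + B)\<bar>"
      by (simp flip: zs(2))
    finally have "root n (\<epsilon> ^ n) \<le> root n \<bar>Determinant.det (x \<cdot>\<^sub>m 1\<^sub>m n + B)\<bar>"
      using \<open>n \<ge> 1\<close> by simp
    with small show False
      using \<open>n \<ge> 1\<close> \<open>\<epsilon> > 0\<close> by (simp add: real_root_power_cancel)
  qed
  with zs(1) show thesis
    using that[of "map Re zs"] by simp
qed

lemma (in prob_space) prob_le_levy_concentration: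
  "prob {w \<in> space M. \<bar>X w - t\<bar> < d} \<le> levy_concentration M X d"
  unfolding levy_concentration_def by (rule cSUP_upper) (auto intro!: bdd_aboveI[of _ 1])

lemma (in prob_space) prob_near_list_le_levy_concentration:
  assumes [measurable]: "random_variable borel X"
  shows "prob {w \<in> space M. \<exists>t\<in>set ts. \<bar>X w - t\<bar> < d} \<le> real (length ts) * levy_concentration M X d"
proof (induction ts)
  case (Cons t ts)
  have "prob {w \<in> space M. \<exists>s\<in>set (t # ts). \<bar>X w - s\<bar> < d}
      = prob ({w \<in> space M. \<bar>X w - t\<bar> < d} \<union> {w \<in> space M. \<exists>s\<in>set ts. \<bar>X w - s\<bar> < d})"
    by (rule arg_cong[where f = prob]) auto
  also have "\<dots> \<le> prob {w \<in> space M. \<bar>X w - t\<bar> < d} + prob {w \<in> space M. \<exists>s\<in>set ts. \<bar>X w - s\<bar> < d}"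
    by (rule measure_Un_le) measurable
  also have "\<dots> \<le> levy_concentration M X d + real (length ts) * levy_concentration M X d"
    by (intro add_mono prob_le_levy_concentration Cons.IH)
  finally show ?case
    by (simp add: algebra_simps)
qed simp

text \<open>This is the conditioning step. By independence the joint law is a product, so the
  probability is an integral over \<open>y\<close> of fibre measures, each controlled by a union
  bound over \<open>n\<close> centres. The centres may vary arbitrarily with \<open>y\<close>, since
  the integral sees only the constant bound \<open>?L\<close>.\<close>

lemma (in prob_space) indep_var_near_list_le_levy_concentration:
  assumes indep: "indep_var K X N Y"
    and [measurable]: "f \<in> borel_measurable K"
    and S: "S \<in> sets (K \<Otimes>\<^sub>M N)"
    and near: "\<And>y. y \<in> space N \<Longrightarrow>
      \<exists>ts. length ts = n \<and> (\<forall>x. (x, y) \<in> S \<longrightarrow> (\<exists>t\<in>set ts. \<bar>f x - t\<bar> < \<epsilon>))"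
  shows "prob {w \<in> space M. (X w, Y w) \<in> S} \<le> real n * levy_concentration M (\<lambda>w. f (X w)) \<epsilon>"
proof -
  have X[measurable]: "random_variable K X" and Y[measurable]: "random_variable N Y"
    and joint: "distr M K X \<Otimes>\<^sub>M distr M N Y = distr M (K \<Otimes>\<^sub>M N) (\<lambda>w. (X w, Y w))"
    using indep by (auto simp: indep_var_distribution_eq)
  interpret X: prob_space "distr M K X" by (rule prob_space_distr) fact
  interpret Y: prob_space "distr M N Y" by (rule prob_space_distr) fact
  interpret XY: pair_sigma_finite "distr M K X" "distr M N Y" ..
  let ?L = "real n * levy_concentration M (\<lambda>w. f (X w)) \<epsilon>"
  \<comment> \<open>The centre \<open>0\<close> is an arbitrary choice: any single probability below
    the supremum shows that \<open>?L\<close> is nonnegative, which the return from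
    \<open>ennreal\<close> to reals requires.\<close>
  have "0 \<le> prob {w \<in> space M. \<bar>f (X w) - 0\<bar> < \<epsilon>}"
    by simp
  also note prob_le_levy_concentration
  finally have L: "0 \<le> ?L"
    by simp
  have fibre: "emeasure (distr M K X) ((\<lambda>x. (x, y)) -` S) \<le> ennreal ?L"
    if y: "y \<in> space N" for y
  proof -
    obtain ts where ts: "length ts = n" "\<And>x. (x, y) \<in> S \<Longrightarrow> \<exists>t\<in>set ts. \<bar>f x - t\<bar> < \<epsilon>"
      using near[OF y] by blast
    have [measurable]: "(\<lambda>x. (x, y)) -` S \<in> sets K"
      using S by (rule sets_Pair2)
    have "emeasure (distr M K X) ((\<lambda>x. (x, y)) -` S)
        = ennreal (prob (X -` (\<lambda>x. (x, y)) -` S \<inter> space M))"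
      by (simp add: emeasure_distr emeasure_eq_measure)
    also have "prob (X -` (\<lambda>x. (x, y)) -` S \<inter> space M) \<le> prob {w \<in> space M. \<exists>t\<in>set ts. \<bar>f (X w) - t\<bar> < \<epsilon>}"
      by (rule finite_measure_mono) (use ts(2) in auto)
    also have "\<dots> \<le> ?L"
      using prob_near_list_le_levy_concentration[of "\<lambda>w. f (X w)" ts \<epsilon>] ts(1) by simp
    finally show ?thesis
      by (simp add: ennreal_leI)
  qed
  have "emeasure M {w \<in> space M. (X w, Y w) \<in> S}
      = emeasure (distr M (K \<Otimes>\<^sub>M N) (\<lambda>w. (X w, Y w))) S"
    using S by (subst emeasure_distr) (auto intro!: arg_cong[where f = "emeasure M"])
  also have "\<dots> = (\<integral>\<^sup>+y. emeasure (distr M K X) ((\<lambda>x. (x, y)) -` S) \<partial>distr M N Y)"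
    unfolding joint[symmetric]
    by (rule XY.emeasure_pair_measure_alt2) (use S in simp)
  also have "\<dots> \<le> (\<integral>\<^sup>+y. ennreal ?L \<partial>distr M N Y)"
    by (rule nn_integral_mono) (use fibre in simp)
  also have "\<dots> = ennreal ?L"
    using Y.emeasure_space_1 by simp
  finally show ?thesis
    using L by (simp add: emeasure_eq_measure)
qed

lemma toeplitz_mat_carrier: "toeplitz_mat n c \<in> carrier_mat n n"
  by (simp add: toeplitz_mat_def)

lemma toeplitz_mat_cong:
  assumes "\<And>k. k \<le> 2 * n - 2 \<Longrightarrow> c k = d k"
  shows "toeplitz_mat n c = toeplitz_mat n d"
  unfolding toeplitz_mat_def using assms by (intro eq_matI) auto

text \<open>Within the matrix, the index \<open>n - 1 + i - j\<close> equals \<open>n - 1\<close>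
  exactly when \<open>i = j\<close>.\<close>

lemma toeplitz_mat_upd_diagonal:
  assumes "n \<ge> 1"
  shows "toeplitz_mat n (c(n - 1 := x)) = x \<cdot>\<^sub>m 1\<^sub>m n + toeplitz_mat n (c(n - 1 := 0))"
  unfolding toeplitz_mat_def using assms by (intro eq_matI) auto

text \<open>By the Leibniz formula the determinant is a polynomial in the entries, whose indices
  never exceed \<open>2 * n - 2\<close>.\<close>

lemma measurable_det_toeplitz_mat:
  assumes "\<And>k. k \<le> 2 * n - 2 \<Longrightarrow> (\<lambda>w. c w k) \<in> borel_measurable N"
  shows "(\<lambda>w. Determinant.det (toeplitz_mat n (c w))) \<in> borel_measurable N"
proof -
  have "(\<lambda>w. toeplitz_mat n (c w) $$ (i, p i)) \<in> borel_measurable N"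
    if "p permutes {0..<n}" "i \<in> {0..<n}" for p i
  proof -
    have "p i < n"
      using permutes_in_image[OF that(1), of i] that(2) by simp
    then show ?thesis
      using that(2) by (simp add: toeplitz_mat_def assms)
  qed
  then show ?thesis
    unfolding det_def'[OF toeplitz_mat_carrier]
    by (intro borel_measurable_sum borel_measurable_times borel_measurable_prod) auto
qed

theorem proposition2p3:
  fixes M :: "'a measure" and a :: "nat \<Rightarrow> 'a \<Rightarrow> real" and n :: nat and \<epsilon> :: real
  assumes "prob_space M"
    and "n \<ge> 1"
    and "prob_space.indep_vars M (\<lambda>_. borel) a {0..2 * n - 2}"
    and "\<epsilon> > 0"
  shows "measure M {w \<in> space M. root n \<bar>Determinant.det (toeplitz_mat n (\<lambda>k. a k w))\<bar> < \<epsilon>}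
           \<le> real n * levy_concentration M (a (n - 1)) \<epsilon>"
proof -
  interpret prob_space M by fact
  define J where "J = {0..2 * n - 2} - {n - 1}"
  \<comment> \<open>The diagonal variable is kept as a function on a singleton, the form produced by
    \<open>indep_var_restrict\<close>; evaluation at \<open>n - 1\<close> recovers its real value
    and plays the part of \<open>f\<close>.\<close>
  define K where "K = (\<Pi>\<^sub>M k\<in>{n - 1}. (borel :: real measure))"
  define N where "N = (\<Pi>\<^sub>M k\<in>J. (borel :: real measure))"
  define X where "X = (\<lambda>w. restrict (\<lambda>k. a k w) {n - 1})"
  define Y where "Y = (\<lambda>w. restrict (\<lambda>k. a k w) J)"
  define T where "T = (\<lambda>(x :: nat \<Rightarrow> real, y). toeplitz_mat n (y(n - 1 := x (n - 1))))"
  define S where "S = {p \<in> space (K \<Otimes>\<^sub>M N). root n \<bar>Determinant.det (T p)\<bar> < \<epsilon>}"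
  have indep: "indep_var K X N Y"
    unfolding K_def X_def N_def Y_def using assms(3)
    by (rule indep_var_restrict) (auto simp: J_def \<open>n \<ge> 1\<close>)
  have diag: "(\<lambda>x. x (n - 1)) \<in> borel_measurable K"
    unfolding K_def by (rule measurable_component_singleton) simp
  have "(\<lambda>p :: (nat \<Rightarrow> real) \<times> (nat \<Rightarrow> real). ((snd p)(n - 1 := fst p (n - 1))) k) \<in> borel_measurable (K \<Otimes>\<^sub>M N)"
    if "k \<le> 2 * n - 2" for k
  proof (cases "k = n - 1")
    case False
    then have "k \<in> J"
      using that by (simp add: J_def)
    then have "(\<lambda>y. y k) \<in> borel_measurable N"
      unfolding N_def by (rule measurable_component_singleton)
    from measurable_compose[OF measurable_snd this] False show ?thesis
      by simp
  next
    case True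
    then show ?thesis
      using measurable_compose[OF measurable_fst diag] by simp
  qed
  then have [measurable]: "(\<lambda>p. Determinant.det (T p)) \<in> borel_measurable (K \<Otimes>\<^sub>M N)"
    unfolding T_def case_prod_beta by (rule measurable_det_toeplitz_mat)
  have S: "S \<in> sets (K \<Otimes>\<^sub>M N)"
    unfolding S_def by measurable
  have near: "\<exists>ts. length ts = n \<and> (\<forall>x. (x, y) \<in> S \<longrightarrow> (\<exists>t\<in>set ts. \<bar>x (n - 1) - t\<bar> < \<epsilon>))" for y
  proof -
    \<comment> \<open>The centres come from the matrix with zero diagonal, which is determined by
      \<open>y\<close> alone.\<close>
    obtain ts where "length ts = n"
      and "\<And>x. root n \<bar>Determinant.det (x \<cdot>\<^sub>m 1\<^sub>m n + toeplitz_mat n (y(n - 1 := 0)))\<bar> < \<epsilon>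
        \<Longrightarrow> \<exists>t\<in>set ts. \<bar>x - t\<bar> < \<epsilon>"
      using det_diagonal_shift_small[OF toeplitz_mat_carrier assms(2,4)] by blast
    then show ?thesis
      unfolding S_def T_def mem_Collect_eq prod.case toeplitz_mat_upd_diagonal[OF assms(2), of y "_ (n - 1)"]
      by blast
  qed
  have "toeplitz_mat n (\<lambda>k. a k w) = T (X w, Y w)" for w
    \<comment> \<open>Restriction makes \<open>Y w\<close> undefined outside \<open>J\<close>. The
      position \<open>n - 1\<close> is overwritten from \<open>X w\<close>, and the remaining ones
      lie beyond \<open>2 * n - 2\<close>, where no entry is read.\<close>
    unfolding T_def prod.case by (rule toeplitz_mat_cong) (auto simp: X_def Y_def J_def)
  moreover have "X w \<in> space K" "Y w \<in> space N" for w
    by (simp_all add: X_def K_def Y_def N_def space_PiM)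
  ultimately have "{w \<in> space M. root n \<bar>Determinant.det (toeplitz_mat n (\<lambda>k. a k w))\<bar> < \<epsilon>}
      = {w \<in> space M. (X w, Y w) \<in> S}"
    by (simp add: S_def space_pair_measure)
  with indep_var_near_list_le_levy_concentration[OF indep diag S near] show ?thesis
    by (simp add: X_def)
qed

end
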